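(* Let $n\ge 1$ and let $A,B\in\mathbb{Y}_n$ be Young diagrams such that there is an $n$-flip between $A$ and $B$. Then for every $k$ such that $A,B\in\mathbb{Y}_k$ there is also a $k$-flip between $A$ and $B$; in particular there is a $k$-flip between $A$ and $B$ for every $k>n$.
   Context: A Young diagram is identified with a partition $D=(d_1,d_2,\dots)$, $d_1\ge d_2\ge\dots\ge 0$ integers, only finitely many nonzero; it is drawn in the fourth quadrant with row $k$ occupying $[0,d_k]\times[-k,-k+1]$. For $n\ge 1$, $\mathbb{Y}_n$ is the set of Young diagrams lying inside the triangle bounded by the coordinate axes and the line $y=x-n$, i.e. those with $d_k\le n-k$ for $1\le k\le n-1$ and $d_k=0$ for $k\ge n$. For $m\ge 3$, label the vertices of a convex $m$-gon $0,1,\dots,m-1$ counterclockwise. A triangulation is a set of diagonals, pairwise either sharing an endpoint or non-intersecting, that divides the polygon into triangles (it has $m-3$ diagonals); $T_m$ denotes the set of triangulations of the $m$-gon. The tail (resp. head) of a diagonal is its smaller (resp. larger) endpoint. For $A\in T_{n+2}$, $\Lambda_{n+2}(A)=(\lambda_1,\dots,\lambda_{n-1},0,0,\dots)$ where $\lambda_1\ge\dots\ge\lambda_{n-1}$ are the tails of the $n-1$ diagonals of $A$ listed in decreasing order; $\Lambda_{n+2}$ is a bijection $T_{n+2}\to\mathbb{Y}_n$. A flip of a triangulation removes one diagonal and replaces it by the other diagonal of the resulting quadrilateral; equivalently, two triangulations are related by a flip iff they differ in exactly one diagonal. For $A,B\in\mathbb{Y}_n$, there is an $n$-flip between $A$ and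 $B$ if $\Lambda_{n+2}^{-1}(A)$ and $\Lambda_{n+2}^{-1}(B)$ are related by a flip. *)

theory Defs
  imports Main "HOL-Library.Multiset"
begin

(* Row k of a diagram (k = 1, 2, ...) is d (k - 1), so that there is no junk value at index 0. *)
definition int_partition :: "(nat \<Rightarrow> nat) \<Rightarrow> bool" where
  "int_partition d \<longleftrightarrow> antimono d \<and> finite {i. d i \<noteq> 0}"

definition row :: "(nat \<Rightarrow> nat) \<Rightarrow> nat \<Rightarrow> nat" where
  "row d k = d (k - 1)"

definition Young :: "nat \<Rightarrow> (nat \<Rightarrow> nat) set" where
  "Young n = {d. int_partition d \<and> (\<forall>k. 1 \<le> k \<and> k \<le> n - 1 \<longrightarrow> row d k \<le> n - k)
                             \<and> (\<forall>k\<ge>n. row d k = 0)}"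

(* A segment joining two vertices is the pair (tail, head) of its smaller and larger endpoint.
   For a set S of labels, sides S and diagonals S are those of the convex polygon spanned by S,
   whose cyclic order is the order of the labels; the m-gon itself is S = {..<m}. *)
definition sides :: "nat set \<Rightarrow> (nat \<times> nat) set" where
  "sides S = {(a, b). a \<in> S \<and> b \<in> S \<and> a < b \<and> (S \<inter> {a<..<b} = {} \<or> S \<subseteq> {a..b})}"

definition diagonals :: "nat set \<Rightarrow> (nat \<times> nat) set" where
  "diagonals S = {(a, b). a \<in> S \<and> b \<in> S \<and> a < b} - sides S"

(* In convex position two segments meet in their interiors iff their endpoints interleave. *)
definition crossing :: "nat \<times> nat \<Rightarrow> nat \<times> nat \<Rightarrow> bool" where
  "crossing e f \<longleftrightarrow> fst e < fst f \<and> fst f < snd e \<and> snd e < snd f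
                 \<or> fst f < fst e \<and> fst e < snd f \<and> snd f < snd e"

(* The pieces into which a non-crossing set D of diagonals divides the m-gon, each given by
   its vertices: its boundary consists of sides of the m-gon and members of D, and no member
   of D cuts through it. *)
definition piece :: "nat \<Rightarrow> (nat \<times> nat) set \<Rightarrow> nat set \<Rightarrow> bool" where
  "piece m D S \<longleftrightarrow> S \<subseteq> {..<m} \<and> card S \<ge> 3
                 \<and> sides S \<subseteq> sides {..<m} \<union> D \<and> diagonals S \<inter> D = {}"

definition triangulations :: "nat \<Rightarrow> (nat \<times> nat) set set" where
  "triangulations m = {D. D \<subseteq> diagonals {..<m} \<and> (\<forall>e\<in>D. \<forall>f\<in>D. \<not> crossing e f)
                        \<and> (\<forall>S. piece m D S \<longrightarrow> card S = 3)}"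

definition tails_desc :: "(nat \<times> nat) set \<Rightarrow> nat list" where
  "tails_desc D = rev (sorted_list_of_multiset (image_mset fst (mset_set D)))"

definition Lam :: "(nat \<times> nat) set \<Rightarrow> nat \<Rightarrow> nat" where
  "Lam D = (\<lambda>i. if i < length (tails_desc D) then tails_desc D ! i else 0)"

(* Removing e merges its two triangles into a quadrilateral Q, whose other diagonal is f. *)
definition flip :: "nat \<Rightarrow> (nat \<times> nat) set \<Rightarrow> (nat \<times> nat) set \<Rightarrow> bool" where
  "flip m X Y \<longleftrightarrow> X \<in> triangulations m \<and> Y \<in> triangulations m
     \<and> (\<exists>e\<in>X. \<exists>f Q. piece m (X - {e}) Q \<and> card Q = 4
            \<and> diagonals Q = {e, f} \<and> f \<noteq> e \<and> Y = insert f (X - {e}))"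

definition young_flip :: "nat \<Rightarrow> (nat \<Rightarrow> nat) \<Rightarrow> (nat \<Rightarrow> nat) \<Rightarrow> bool" where
  "young_flip n A B \<longleftrightarrow> A \<in> Young n \<and> B \<in> Young n
     \<and> flip (n + 2) (inv_into (triangulations (n + 2)) Lam A)
                    (inv_into (triangulations (n + 2)) Lam B)"

end

(*
  Gluing the triangle (0, N, N+1) onto the side (0, N) of the (N+1)-gon turns a triangulation X
  into X with the diagonal (0, N) added, which contributes a tail 0 and hence leaves Lam unchanged.
  As Lam is a bijection, this gluing is the inclusion of Young n into Young (n+1).  It preserves
  flips, and reflects them too, since a flip between two triangulations that both contain (0, N)
  cannot touch that diagonal.

  For the bijectivity of Lam, process the tails v in decreasing order: the diagonals with tail v
  join v to an initial segment of the vertices that are not hidden behind a diagonal with larger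
  tail.  So the number of diagonals of each tail determines them all, and conversely a choice of
  these numbers can be realised as long as enough visible vertices remain, which is the triangle
  condition on the Young diagram.
*)
theory Submission imports Defs begin

section \<open>Visible vertices and edges equipped with an apex\<close>

definition visible :: "(nat \<times> nat) set \<Rightarrow> nat \<Rightarrow> nat \<Rightarrow> nat set" where
  "visible F a b = {x \<in> {a..b}. \<forall>e\<in>F. \<not> (fst e < x \<and> x < snd e)}"

definition apex_closed :: "nat \<Rightarrow> nat \<Rightarrow> (nat \<times> nat) set \<Rightarrow> bool" where
  "apex_closed v N F \<longleftrightarrow>
     (\<forall>(a, b)\<in>F. v \<le> a \<and> Suc a < b \<and> b \<le> N)
     \<and> (\<forall>e\<in>F. \<forall>f\<in>F. \<not> crossing e f)
     \<and> (\<forall>(a, b)\<in>F. \<exists>x. a < x \<and> x < b \<and> (x = Suc a \<or> (a, x) \<in> F) \<and> (b = Suc x \<or> (x, b) \<in> F))"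

text \<open>The third condition gives every edge (a, b) a triangle on its side between a and b. With the side
  (0, N) included as an edge, this local property characterises triangulations and is easier to
  build up one tail at a time than the condition on pieces.\<close>

lemma finite_visible [simp]: "finite (visible F a b)"
  by (simp add: visible_def)

lemma apex_closed_edge:
  assumes "apex_closed v N F" "(a, b) \<in> F"
  shows "v \<le> a" "Suc a < b" "b \<le> N"
  using assms by (auto simp: apex_closed_def)

lemma apex_closed_not_crossing:
  assumes "apex_closed v N F" "(a, b) \<in> F" "(c, d) \<in> F" "a < c" "c < b" "b < d"
  shows False
proof -
  have "\<not> crossing (a, b) (c, d)"
    using assms(1,2,3) unfolding apex_closed_def by blast
  then show False using assms(4-) by (simp add: crossing_def)
qed

lemma apex_closed_apex:
  assumes "apex_closed v N F" "(a, b) \<in> F"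
  obtains x where "a < x" "x < b" "x = Suc a \<or> (a, x) \<in> F" "b = Suc x \<or> (x, b) \<in> F"
  using assms unfolding apex_closed_def by fast

lemma apex_closed_finite:
  assumes "apex_closed v N F"
  shows "finite F"
proof (rule finite_subset)
  show "F \<subseteq> {..N} \<times> {..N}"
    using apex_closed_edge[OF assms] by fastforce
qed simp

text \<open>Every vertex strictly between x and y is hidden by an edge of F, and this edge stays
  within [x, y] because x and y are visible. Among the edges from x that end by y, the longest one
  must reach y: if it stopped at m < y, an edge hiding m would either start at x and be longer, or
  cross it.\<close>

lemma visible_consecutive:
  assumes nc: "\<forall>e\<in>F. \<forall>f\<in>F. \<not> crossing e f"
    and x: "x \<in> visible F a b" and y: "y \<in> visible F a b" and xy: "x < y"
    and gap: "visible F a b \<inter> {x<..<y} = {}"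
  shows "y = Suc x \<or> (x, y) \<in> F"
proof (rule ccontr)
  assume H: "\<not> (y = Suc x \<or> (x, y) \<in> F)"
  have ab: "a \<le> x" "y \<le> b" using x y by (auto simp: visible_def)
  have cover: "\<exists>u w. (u, w) \<in> F \<and> x \<le> u \<and> u < z \<and> z < w \<and> w \<le> y" if z: "x < z" "z < y" for z
  proof -
    have "z \<notin> visible F a b" using gap z by auto
    then obtain u w where uw: "(u, w) \<in> F" "u < z" "z < w"
      using ab z by (force simp: visible_def)
    moreover have "x \<le> u" using x uw z by (force simp: visible_def)
    moreover have "w \<le> y" using y uw z by (force simp: visible_def)
    ultimately show ?thesis by blast
  qed
  let ?W = "{w. (x, w) \<in> F \<and> w \<le> y}"
  have fin: "finite ?W" by (rule finite_subset[of _ "{..y}"]) auto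
  obtain u w where "(u, w) \<in> F" "x \<le> u" "u < Suc x" "Suc x < w" "w \<le> y"
    using cover[of "Suc x"] H xy by force
  then have w: "w \<in> ?W" "x < w" by (auto simp: le_less_Suc_eq)
  define m where "m = Max ?W"
  have m: "m \<in> ?W" using Max_in[OF fin] w m_def by blast
  have "w \<le> m" using Max_ge[OF fin w(1)] by (simp add: m_def)
  then have "x < m" using w by simp
  moreover have "m < y" using m H by (auto simp: less_le)
  ultimately obtain u' w' where u': "(u', w') \<in> F" "x \<le> u'" "u' < m" "m < w'" "w' \<le> y"
    using cover by blast
  have "u' \<noteq> x"
  proof
    assume "u' = x"
    then have "w' \<in> ?W" using u' by simp
    then have "w' \<le> m" unfolding m_def by (rule Max_ge[OF fin])
    then show False using u' by simp
  qed
  then have "crossing (x, m) (u', w')" using u' by (simp add: crossing_def)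
  then show False using nc m u' by blast
qed

section \<open>Triangulations as apex-closed sets of edges\<close>

lemma sides_polygon:
  assumes "2 \<le> N"
  shows "sides {..<Suc N} = {(a, b). b = Suc a \<and> b \<le> N} \<union> {(0, N)}"
proof -
  have "(a, b) \<in> sides {..<Suc N} \<longleftrightarrow> b = Suc a \<and> b \<le> N \<or> (a, b) = (0, N)" for a b
  proof
    assume L: "(a, b) \<in> sides {..<Suc N}"
    then have ab: "a < b" "b \<le> N" by (auto simp: sides_def)
    have "{..<Suc N} \<inter> {a<..<b} = {} \<or> {..<Suc N} \<subseteq> {a..b}" using L by (simp add: sides_def)
    then show "b = Suc a \<and> b \<le> N \<or> (a, b) = (0, N)"
    proof
      assume "{..<Suc N} \<inter> {a<..<b} = {}"
      then have "Suc a \<notin> {..<Suc N} \<inter> {a<..<b}" by simp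
      then show ?thesis using ab by auto
    next
      assume "{..<Suc N} \<subseteq> {a..b}"
      then have "0 \<in> {a..b}" "N \<in> {a..b}" by auto
      then show ?thesis using ab by auto
    qed
  next
    assume "b = Suc a \<and> b \<le> N \<or> (a, b) = (0, N)"
    then show "(a, b) \<in> sides {..<Suc N}" using assms by (auto simp: sides_def)
  qed
  then show ?thesis by auto
qed

lemma diagonals_polygon:
  assumes "2 \<le> N"
  shows "diagonals {..<Suc N} = {(a, b). Suc a < b \<and> b \<le> N} - {(0, N)}"
  unfolding diagonals_def sides_polygon[OF assms] by auto

text \<open>S is the piece directly below the edge (a, b). That edge is left out of the hiding set,
  since it would hide everything between its ends. Neighbours in S are joined by
  \<open>visible_consecutive\<close>, and a member of D that cut through S would hide a vertex of
  S.\<close>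

lemma visible_piece:
  assumes N: "2 \<le> N" and D: "D \<subseteq> diagonals {..<Suc N}" and nc: "\<forall>e\<in>D. \<forall>f\<in>D. \<not> crossing e f"
    and ab: "(a, b) \<in> insert (0, N) D"
  defines "S \<equiv> visible {e \<in> D. a \<le> fst e \<and> snd e \<le> b \<and> e \<noteq> (a, b)} a b"
  shows "piece (Suc N) D S" "a \<in> S" "b \<in> S"
proof -
  define F where "F = {e \<in> D. a \<le> fst e \<and> snd e \<le> b \<and> e \<noteq> (a, b)}"
  have S: "S = visible F a b" by (simp add: S_def F_def)
  have ncF: "\<forall>e\<in>F. \<forall>f\<in>F. \<not> crossing e f" using nc by (auto simp: F_def)
  have lt: "Suc a < b" "b \<le> N" using ab D N by (auto simp: diagonals_polygon)
  show aS: "a \<in> S" and bS: "b \<in> S" using lt by (auto simp: S visible_def F_def)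
  have sub: "S \<subseteq> {a..b}" by (auto simp: S visible_def)
  \<comment> \<open>Otherwise a and b would be consecutive visible vertices, joined by a polygon
    side \<open>(a, Suc a)\<close> or by a member of F; both are impossible.\<close>
  have "S \<inter> {a<..<b} \<noteq> {}"
  proof
    assume "S \<inter> {a<..<b} = {}"
    then have "b = Suc a \<or> (a, b) \<in> F"
      using visible_consecutive[OF ncF, of a a b b] aS bS lt by (simp add: S)
    then show False using lt by (simp add: F_def)
  qed
  then obtain x where x: "x \<in> S" "a < x" "x < b" by auto
  have fin: "finite S" by (simp add: S)
  have "card {a, x, b} \<le> card S" using aS bS x fin by (intro card_mono) auto
  then have c3: "3 \<le> card S" using x by simp
  have "sides S \<subseteq> sides {..<Suc N} \<union> D"
  proof (rule subrelI)
    fix p q assume pq: "(p, q) \<in> sides S"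
    then have *: "p \<in> S" "q \<in> S" "p < q" "S \<inter> {p<..<q} = {} \<or> S \<subseteq> {p..q}" by (auto simp: sides_def)
    from *(4) show "(p, q) \<in> sides {..<Suc N} \<union> D"
    proof
      assume "S \<inter> {p<..<q} = {}"
      then have "q = Suc p \<or> (p, q) \<in> F"
        using visible_consecutive[OF ncF] * by (simp add: S)
      moreover have "q \<le> N" using * sub lt by auto
      ultimately show ?thesis using N by (auto simp: F_def sides_polygon)
    next
      assume "S \<subseteq> {p..q}"
      then have "p = a" "q = b" using aS bS * sub by force+
      then show ?thesis using ab N by (auto simp: sides_polygon)
    qed
  qed
  moreover have "diagonals S \<inter> D = {}"
  proof -
    have False if "(p, q) \<in> diagonals S" "(p, q) \<in> D" for p q
    proof -
      have pq: "p \<in> S" "q \<in> S" "p < q" "S \<inter> {p<..<q} \<noteq> {}" "\<not> S \<subseteq> {p..q}"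
        using that by (auto simp: diagonals_def sides_def)
      then have "(p, q) \<in> F" using that sub by (auto simp: F_def)
      then show False using pq(4) by (force simp: S visible_def)
    qed
    then show ?thesis by auto
  qed
  ultimately show "piece (Suc N) D S"
    using c3 sub lt by (auto simp: piece_def)
qed

text \<open>The piece directly below an edge contains both its ends. In a triangulation it has just
  one more vertex, and this is the apex.\<close>

lemma triangulation_apex_closed:
  assumes N: "2 \<le> N" and D: "D \<in> triangulations (Suc N)"
  shows "(0, N) \<notin> D" "apex_closed 0 N (insert (0, N) D)"
proof -
  have sub: "D \<subseteq> diagonals {..<Suc N}" and nc: "\<forall>e\<in>D. \<forall>f\<in>D. \<not> crossing e f"
    and pc: "\<And>S. piece (Suc N) D S \<Longrightarrow> card S = 3"
    using D by (auto simp: triangulations_def)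
  show "(0, N) \<notin> D" using sub N by (auto simp: diagonals_polygon)
  have bd: "Suc a < b \<and> b \<le> N" if "(a, b) \<in> insert (0, N) D" for a b
    using that sub N by (auto simp: diagonals_polygon)
  have nc': "\<not> crossing e f" if "e \<in> insert (0, N) D" "f \<in> insert (0, N) D" for e f
  proof -
    have "snd e \<le> N" "snd f \<le> N" using bd[of "fst e" "snd e"] bd[of "fst f" "snd f"] that by auto
    then show ?thesis using that nc by (auto simp: crossing_def)
  qed
  have ap: "\<exists>x. a < x \<and> x < b \<and> (x = Suc a \<or> (a, x) \<in> D) \<and> (b = Suc x \<or> (x, b) \<in> D)"
    if ab: "(a, b) \<in> insert (0, N) D" for a b
  proof -
    define F where "F = {e \<in> D. a \<le> fst e \<and> snd e \<le> b \<and> e \<noteq> (a, b)}"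
    define S where "S = visible F a b"
    have S: "piece (Suc N) D S" "a \<in> S" "b \<in> S"
      using visible_piece[OF N sub nc ab] by (simp_all add: S_def F_def)
    have c: "card S = 3" using pc S by blast
    have ncF: "\<forall>e\<in>F. \<forall>f\<in>F. \<not> crossing e f" using nc by (auto simp: F_def)
    have "Suc a < b" using bd ab by blast
    then have "card (S - {a, b}) = 1" using c S by (simp add: card_Diff_subset)
    then obtain x where x: "S - {a, b} = {x}" using card_1_singletonE by blast
    then have Seq: "S = {a, x, b}" "x \<noteq> a" "x \<noteq> b" using S by auto
    have "x \<in> {a..b}" using Seq by (auto simp: S_def visible_def)
    then have axb: "a < x" "x < b" using Seq by auto
    have "x = Suc a \<or> (a, x) \<in> F"
      using visible_consecutive[OF ncF, of a a b x] Seq axb by (auto simp: S_def[symmetric])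
    moreover have "b = Suc x \<or> (x, b) \<in> F"
      using visible_consecutive[OF ncF, of x a b b] Seq axb by (auto simp: S_def[symmetric])
    ultimately show ?thesis using axb by (auto simp: F_def)
  qed
  show "apex_closed 0 N (insert (0, N) D)"
    unfolding apex_closed_def
  proof (intro conjI)
    show "\<forall>(a, b)\<in>insert (0, N) D. 0 \<le> a \<and> Suc a < b \<and> b \<le> N" using bd by blast
    show "\<forall>e\<in>insert (0, N) D. \<forall>f\<in>insert (0, N) D. \<not> crossing e f" using nc' by blast
    show "\<forall>(a, b)\<in>insert (0, N) D. \<exists>x. a < x \<and> x < b
        \<and> (x = Suc a \<or> (a, x) \<in> insert (0, N) D) \<and> (b = Suc x \<or> (x, b) \<in> insert (0, N) D)"
    proof (intro ballI, clarify)
      fix a b assume "(a, b) \<in> insert (0, N) D"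
      from ap[OF this] show "\<exists>x. a < x \<and> x < b
        \<and> (x = Suc a \<or> (a, x) \<in> insert (0, N) D) \<and> (b = Suc x \<or> (x, b) \<in> insert (0, N) D)"
        by (elim exE) auto
    qed
  qed
qed

text \<open>The extreme vertices a and b of a piece S form a side of S, hence an edge. The apex x of
  that edge belongs to S, and any further vertex of S would make (a, x) or (x, b) a diagonal of S
  that lies in D.\<close>

lemma apex_closed_triangulation:
  assumes N: "2 \<le> N" and D: "(0, N) \<notin> D" and G: "apex_closed 0 N (insert (0, N) D)"
  shows "D \<in> triangulations (Suc N)"
proof -
  have sub: "D \<subseteq> diagonals {..<Suc N}"
    using apex_closed_edge[OF G] N D by (auto simp: diagonals_polygon)
  have nc: "\<forall>e\<in>D. \<forall>f\<in>D. \<not> crossing e f" using G by (simp add: apex_closed_def)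
  have "card S = 3" if S: "piece (Suc N) D S" for S
  proof -
    have SN: "S \<subseteq> {..<Suc N}" and c: "3 \<le> card S" and sd: "sides S \<subseteq> sides {..<Suc N} \<union> D"
      and dg: "diagonals S \<inter> D = {}" using S by (auto simp: piece_def)
    have fin: "finite S" using SN finite_subset by blast
    have ne: "S \<noteq> {}" using c by auto
    define a where "a = Min S"
    define b where "b = Max S"
    have a: "a \<in> S" and b: "b \<in> S" and ab: "\<And>s. s \<in> S \<Longrightarrow> a \<le> s \<and> s \<le> b"
      using fin ne by (auto simp: a_def b_def)
    have bN: "b \<le> N" using b SN by auto
    obtain t where t: "t \<in> S" "t \<noteq> a" "t \<noteq> b"
    proof -
      have "\<not> S \<subseteq> {a, b}"
      proof
        assume "S \<subseteq> {a, b}"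
        then have "card S \<le> card {a, b}" by (intro card_mono) auto
        also have "\<dots> \<le> 2" by (simp add: card_insert_if)
        finally show False using c by simp
      qed
      then show thesis using that by auto
    qed
    have atb: "a < t" "t < b" using t ab[of t] by auto
    have edge: "(p, q) \<in> insert (0, N) D" if "(p, q) \<in> sides S" "q \<noteq> Suc p" for p q
      using that sd N by (auto simp: sides_polygon)
    have "(a, b) \<in> sides S" using a b ab atb by (auto simp: sides_def)
    then have abG: "(a, b) \<in> insert (0, N) D" using edge atb by auto
    obtain x where x: "a < x" "x < b" "x = Suc a \<or> (a, x) \<in> insert (0, N) D"
      "b = Suc x \<or> (x, b) \<in> insert (0, N) D"
      using apex_closed_apex[OF G abG] by blast
    have xS: "x \<in> S"
    proof (rule ccontr)
      assume nx: "x \<notin> S"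
      \<comment> \<open>The neighbours p and q of x in S form a side of S, which is therefore an
        edge. As it crosses neither (a, x) nor (x, b), it must be (a, b), and this leaves no room
        for t.\<close>
      let ?P = "{s \<in> S. s < x}" and ?Q = "{s \<in> S. x < s}"
      define p where "p = Max ?P"
      define q where "q = Min ?Q"
      have p: "p \<in> ?P" "\<And>s. s \<in> ?P \<Longrightarrow> s \<le> p"
      proof -
        have "finite ?P" "a \<in> ?P" using fin a x(1) by auto
        then show "p \<in> ?P" "\<And>s. s \<in> ?P \<Longrightarrow> s \<le> p"
          unfolding p_def using Max_in[of ?P] Max_ge[of ?P] by blast+
      qed
      have q: "q \<in> ?Q" "\<And>s. s \<in> ?Q \<Longrightarrow> q \<le> s"
      proof -
        have "finite ?Q" "b \<in> ?Q" using fin b x(2) by auto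
        then show "q \<in> ?Q" "\<And>s. s \<in> ?Q \<Longrightarrow> q \<le> s"
          unfolding q_def using Min_in[of ?Q] Min_le[of ?Q] by blast+
      qed
      have gap: "S \<inter> {p<..<q} = {}"
      proof -
        have "s \<le> p \<or> q \<le> s" if "s \<in> S" for s
          using that p(2)[of s] q(2)[of s] nx by (cases s x rule: linorder_cases) auto
        then show ?thesis by force
      qed
      have "(p, q) \<in> sides S" using p q gap by (auto simp: sides_def)
      then have pq: "(p, q) \<in> insert (0, N) D" using edge p q by auto
      have "p = a"
      proof (rule ccontr)
        assume "p \<noteq> a"
        then have "a < p" using p ab[of p] by auto
        then have "(a, x) \<in> insert (0, N) D" using x p by auto
        then show False using apex_closed_not_crossing[OF G _ pq] \<open>a < p\<close> p q by auto
      qed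
      moreover have "q = b"
      proof (rule ccontr)
        assume "q \<noteq> b"
        then have "q < b" using q ab[of q] by auto
        then have "(x, b) \<in> insert (0, N) D" using x q by auto
        then show False using apex_closed_not_crossing[OF G pq] \<open>q < b\<close> p q by auto
      qed
      ultimately show False using gap t atb by auto
    qed
    have "s \<in> {a, x, b}" if s: "s \<in> S" for s
    proof (rule ccontr)
      assume ns: "s \<notin> {a, x, b}"
      then have asb: "a < s" "s < b" using ab[OF s] by auto
      show False
      proof (cases "s < x")
        case True
        have "(a, x) \<in> diagonals S"
          using a b xS s asb True x by (auto simp: diagonals_def sides_def)
        moreover have "(a, x) \<in> D" using x True asb bN by auto
        ultimately show False using dg by blast
      next
        case False
        then have "x < s" using ns by simp
        then have "(x, b) \<in> diagonals S"
          using a b xS s asb x by (auto simp: diagonals_def sides_def)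
        moreover have "(x, b) \<in> D" using x \<open>x < s\<close> asb by auto
        ultimately show False using dg by blast
      qed
    qed
    then have "S = {a, x, b}" using a b xS by auto
    then show "card S = 3" using x by simp
  qed
  then show ?thesis using sub nc by (simp add: triangulations_def)
qed


section \<open>Injectivity of \<open>Lam\<close>\<close>

lemma initial_segments_eq:
  fixes V :: "'a::linorder set"
  assumes "H \<subseteq> V" "\<And>x y. x \<in> H \<Longrightarrow> y \<in> V \<Longrightarrow> y < x \<Longrightarrow> y \<in> H"
    and "H' \<subseteq> V" "\<And>x y. x \<in> H' \<Longrightarrow> y \<in> V \<Longrightarrow> y < x \<Longrightarrow> y \<in> H'"
    and fin: "finite H" "finite H'" and card: "card H = card H'"
  shows "H = H'"
proof -
  have "H \<subseteq> H' \<or> H' \<subseteq> H"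
  proof (rule ccontr)
    assume "\<not> ?thesis"
    then obtain x y where "x \<in> H" "x \<notin> H'" "y \<in> H'" "y \<notin> H" by blast
    then show False using assms(1-4) by (cases x y rule: linorder_cases) blast+
  qed
  then show ?thesis using card_subset_eq fin card by metis
qed

lemma apex_closed_heads_visible:
  assumes G: "apex_closed 0 N G" and b: "(v, b) \<in> G"
  shows "b \<in> visible {e \<in> G. v < fst e} (Suc v) N" "Suc v < b"
proof -
  have "Suc v < b" "b \<le> N" using apex_closed_edge[OF G b] by auto
  moreover have "\<not> (u < b \<and> b < w)" if "(u, w) \<in> G" "v < u" for u w
    using apex_closed_not_crossing[OF G b that(1)] that by blast
  ultimately show "b \<in> visible {e \<in> G. v < fst e} (Suc v) N" "Suc v < b"
    by (auto simp: visible_def)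
qed

text \<open>Take the least head w >= y of an edge from v. If w > y, minimality puts the apex x of
  (v, w) before y, and then (x, w) is an edge with larger tail that hides y.\<close>

lemma apex_closed_heads_initial:
  assumes G: "apex_closed 0 N G" and b: "(v, b) \<in> G"
    and y: "y \<in> visible {e \<in> G. v < fst e} (Suc v) N" "Suc v < y" "y < b"
  shows "(v, y) \<in> G"
proof (rule ccontr)
  assume ny: "(v, y) \<notin> G"
  define w where "w = (LEAST w. (v, w) \<in> G \<and> y \<le> w)"
  have w: "(v, w) \<in> G \<and> y \<le> w"
    unfolding w_def using LeastI[of "\<lambda>w. (v, w) \<in> G \<and> y \<le> w" b] b y(3) by simp
  have min: "w \<le> z" if "(v, z) \<in> G" "y \<le> z" for z
    unfolding w_def using Least_le[of "\<lambda>w. (v, w) \<in> G \<and> y \<le> w" z] that by simp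
  have "y < w" using w ny by (auto simp: le_less)
  obtain x where x: "v < x" "x < w" "x = Suc v \<or> (v, x) \<in> G" "w = Suc x \<or> (x, w) \<in> G"
    using apex_closed_apex[OF G] w by blast
  have "x < y"
  proof (rule ccontr)
    assume "\<not> x < y"
    then have "(v, x) \<in> G" using x y by auto
    then show False using min[of x] x \<open>\<not> x < y\<close> by auto
  qed
  then have "(x, w) \<in> G" using x \<open>y < w\<close> by auto
  then show False using y(1) \<open>x < y\<close> \<open>y < w\<close> x(1) by (force simp: visible_def)
qed

lemma tails_split:
  fixes G :: "(nat \<times> nat) set"
  shows "{e \<in> G. v \<le> fst e} = {e \<in> G. Suc v \<le> fst e} \<union> Pair v ` {b. (v, b) \<in> G}"
  by (auto simp: le_less Suc_le_eq)

lemma card_tails_split: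
  fixes G :: "(nat \<times> nat) set"
  assumes "finite G"
  shows "card {e \<in> G. v \<le> fst e} = card {e \<in> G. Suc v \<le> fst e} + card {b. (v, b) \<in> G}"
proof -
  have "finite (Pair v ` {b. (v, b) \<in> G})"
    by (rule finite_subset[OF _ assms]) auto
  then show ?thesis
    unfolding tails_split[of G v] using assms
    by (subst card_Un_disjoint) (auto simp: card_image inj_on_def)
qed

text \<open>Descending induction on v shows that the edges with tail at least v agree. The edges
  with larger tails fix the visible vertices; the heads at v form an initial segment of these, and
  its size is a difference of two of the given counts.\<close>

lemma apex_closed_eqI:
  assumes G: "apex_closed 0 N G" "(0, N) \<in> G" and G': "apex_closed 0 N G'" "(0, N) \<in> G'"
    and card: "\<And>v. 1 \<le> v \<Longrightarrow> card {e \<in> G. v \<le> fst e} = card {e \<in> G'. v \<le> fst e}"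
  shows "G = G'"
proof -
  have fin: "finite G" "finite G'" using G G' apex_closed_finite by auto
  have finH: "finite {b. (v, b) \<in> E}" if "finite E" for v and E :: "(nat \<times> nat) set"
  proof -
    have "{b. (v, b) \<in> E} \<subseteq> snd ` E" by force
    then show ?thesis using that finite_subset by blast
  qed
  have "{e \<in> G. v \<le> fst e} = {e \<in> G'. v \<le> fst e}" if "v \<le> N" for v
    using that
  proof (induction v rule: inc_induct)
    case base
    have none: "{e \<in> E. N \<le> fst e} = {}" if "apex_closed 0 N E" for E
      using apex_closed_edge[OF that] by fastforce
    show ?case unfolding none[OF G(1)] none[OF G'(1)] ..
  next
    case (step v)
    define V where "V = {y \<in> visible {e \<in> G. v < fst e} (Suc v) N. Suc v < y}"
    have V': "V = {y \<in> visible {e \<in> G'. v < fst e} (Suc v) N. Suc v < y}"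
      using step.IH by (simp add: V_def Suc_le_eq)
    have sub: "{b. (v, b) \<in> G} \<subseteq> V" "{b. (v, b) \<in> G'} \<subseteq> V"
      using apex_closed_heads_visible[OF G(1)] apex_closed_heads_visible[OF G'(1)]
      unfolding V_def by (blast, simp add: V'[unfolded V_def] subset_iff)
    have ini: "(v, y) \<in> G" if "(v, x) \<in> G" "y \<in> V" "y < x" for x y
      using apex_closed_heads_initial[OF G(1)] that by (auto simp: V_def)
    have ini': "(v, y) \<in> G'" if "(v, x) \<in> G'" "y \<in> V" "y < x" for x y
      using apex_closed_heads_initial[OF G'(1)] that by (auto simp: V')
    have H: "{b. (v, b) \<in> G} = {b. (v, b) \<in> G'}"
    proof (cases "v = 0")
      \<comment> \<open>The counts are given only from tail 1 on. At tail 0 the common head N forces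
        both initial segments to be all of V.\<close>
      case True
      have "y \<le> N" if "y \<in> V" for y using that by (simp add: V_def visible_def)
      then have "{b. (v, b) \<in> G} = V" "{b. (v, b) \<in> G'} = V"
        using sub ini[of N] ini'[of N] G(2) G'(2) True by (auto simp: le_less)
      then show ?thesis by simp
    next
      case False
      then have "card {b. (v, b) \<in> G} = card {b. (v, b) \<in> G'}"
        using card[of v] card[of "Suc v"] card_tails_split[OF fin(1), of v]
          card_tails_split[OF fin(2), of v] by simp
      then show ?thesis
        using sub ini ini' finH[OF fin(1)] finH[OF fin(2)]
        by (intro initial_segments_eq[of _ V]) auto
    qed
    show ?case unfolding tails_split[of _ v] H step.IH ..
  qed
  from this[of 0] show ?thesis by simp
qed

lemma mset_tails_desc: "mset (tails_desc D) = image_mset fst (mset_set D)"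
  by (simp add: tails_desc_def)

text \<open>This is the length of column v of the diagram. Working with columns replaces the sorted
  list by cardinalities; v >= 1 keeps out the zeros with which \<open>Lam\<close> pads the
  list.\<close>

lemma card_Lam_ge:
  assumes "1 \<le> v" "finite D"
  shows "card {i. v \<le> Lam D i} = card {e \<in> D. v \<le> fst e}"
proof -
  have "{i. v \<le> Lam D i} = {i. i < length (tails_desc D) \<and> v \<le> tails_desc D ! i}"
    using assms by (auto simp: Lam_def)
  then have "card {i. v \<le> Lam D i} = length (filter ((\<le>) v) (tails_desc D))"
    by (simp add: length_filter_conv_card)
  also have "\<dots> = size (filter_mset ((\<le>) v) (mset (tails_desc D)))"
    by (metis mset_filter size_mset)
  also have "\<dots> = card {e \<in> D. v \<le> fst e}"
    using assms(2) by (simp add: mset_tails_desc filter_mset_image_mset)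
  finally show ?thesis .
qed

lemma antimono_Lam: "antimono (Lam D)"
proof (rule antimonoI)
  fix i j :: nat assume "i \<le> j"
  then show "Lam D j \<le> Lam D i"
    by (auto simp: Lam_def tails_desc_def rev_nth sorted_nth_mono)
qed

lemma finite_Lam_ge:
  assumes "1 \<le> v"
  shows "finite {i. v \<le> Lam D i}"
  by (rule finite_subset[of _ "{..<length (tails_desc D)}"]) (use assms in \<open>auto simp: Lam_def split: if_splits\<close>)

text \<open>The columns determine a diagram: the level sets of an antitone sequence are initial
  segments, so their sizes fix them.\<close>

lemma antimono_eqI:
  fixes f g :: "nat \<Rightarrow> nat"
  assumes "antimono f" "antimono g"
    and fin: "\<And>v. 1 \<le> v \<Longrightarrow> finite {i. v \<le> f i}" "\<And>v. 1 \<le> v \<Longrightarrow> finite {i. v \<le> g i}"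
    and card: "\<And>v. 1 \<le> v \<Longrightarrow> card {i. v \<le> f i} = card {i. v \<le> g i}"
  shows "f = g"
proof -
  have eq: "{i. v \<le> f i} = {i. v \<le> g i}" if "1 \<le> v" for v
  proof (rule initial_segments_eq[of _ UNIV])
    fix x y :: nat assume "y < x"
    then have "f x \<le> f y" "g x \<le> g y" using assms(1,2) by (auto simp: antimono_def)
    then show "x \<in> {i. v \<le> f i} \<Longrightarrow> y \<in> {i. v \<le> f i}" "x \<in> {i. v \<le> g i} \<Longrightarrow> y \<in> {i. v \<le> g i}"
      by auto
  qed (use fin card that in auto)
  show ?thesis
  proof
    fix i
    have "f i \<le> g i" using eq[of "f i"] by (cases "f i = 0") auto
    moreover have "g i \<le> f i" using eq[of "g i"] by (cases "g i = 0") auto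
    ultimately show "f i = g i" by simp
  qed
qed

lemma triangulation_finite:
  assumes "D \<in> triangulations m"
  shows "finite D"
proof (rule finite_subset)
  show "D \<subseteq> {..<m} \<times> {..<m}" using assms by (auto simp: triangulations_def diagonals_def)
qed simp

lemma inj_on_Lam:
  assumes N: "2 \<le> N"
  shows "inj_on Lam (triangulations (Suc N))"
proof (rule inj_onI)
  fix X Y assume X: "X \<in> triangulations (Suc N)" and Y: "Y \<in> triangulations (Suc N)"
    and L: "Lam X = Lam Y"
  have "insert (0, N) X = insert (0, N) Y"
  proof (rule apex_closed_eqI)
    fix v :: nat assume v: "1 \<le> v"
    have "{e \<in> insert (0, N) X. v \<le> fst e} = {e \<in> X. v \<le> fst e}"
      "{e \<in> insert (0, N) Y. v \<le> fst e} = {e \<in> Y. v \<le> fst e}" using v by auto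
    then show "card {e \<in> insert (0, N) X. v \<le> fst e} = card {e \<in> insert (0, N) Y. v \<le> fst e}"
      using card_Lam_ge[OF v triangulation_finite[OF X]] card_Lam_ge[OF v triangulation_finite[OF Y]] L
      by simp
  qed (use triangulation_apex_closed[OF N] X Y in auto)
  then show "X = Y" using triangulation_apex_closed(1)[OF N] X Y by (metis insert_ident)
qed

section \<open>Surjectivity of \<open>Lam\<close>: building a triangulation tail by tail\<close>

text \<open>The head of a new edge is visible, so no edge of F straddles it, and edges with the
  common tail v do not cross each other. The apex of a new edge (v, b) is the visible vertex p just
  before b: \<open>visible_consecutive\<close> joins p to b, and p is \<open>Suc v\<close> or itself
  a head. The choice x = \<open>Suc v\<close> adds no edge.\<close>

lemma apex_closed_fan:
  assumes F: "apex_closed (Suc v) N F" and x: "x \<in> visible F (Suc v) N"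
  shows "apex_closed v N (F \<union> Pair v ` {y \<in> visible F (Suc v) N. Suc v < y \<and> y \<le> x})"
    (is "apex_closed v N (F \<union> Pair v ` ?H)")
proof -
  let ?G = "F \<union> Pair v ` ?H"
  have ncF: "\<forall>e\<in>F. \<forall>f\<in>F. \<not> crossing e f" using F by (simp add: apex_closed_def)
  have bounds: "v \<le> a \<and> Suc a < b \<and> b \<le> N" if "(a, b) \<in> ?G" for a b
    using that apex_closed_edge[OF F] by (fastforce simp: visible_def)
  have new: "\<not> crossing (v, y) e \<and> \<not> crossing e (v, y)" if "y \<in> visible F (Suc v) N" "e \<in> F" for y e
    using that apex_closed_edge[OF F, of "fst e" "snd e"] by (force simp: crossing_def visible_def)
  have "\<not> crossing e f" if "e \<in> ?G" "f \<in> ?G" for e f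
  proof -
    have "\<not> crossing (v, y) (v, y')" for y y' by (simp add: crossing_def)
    then show ?thesis using that ncF new by blast
  qed
  moreover have "\<exists>x. a < x \<and> x < b \<and> (x = Suc a \<or> (a, x) \<in> ?G) \<and> (b = Suc x \<or> (x, b) \<in> ?G)"
    if ab: "(a, b) \<in> ?G" for a b
  proof (cases "(a, b) \<in> F")
    case True
    then show ?thesis using apex_closed_apex[OF F True] by blast
  next
    case False
    then have a: "a = v" and b: "b \<in> ?H" using ab by auto
    let ?P = "{y \<in> visible F (Suc v) N. y < b}"
    define p where "p = Max ?P"
    have "Suc v \<in> visible F (Suc v) N"
      using b apex_closed_edge[OF F] by (fastforce simp: visible_def)
    then have "Suc v \<in> ?P" using b by blast
    moreover have "finite ?P" by simp
    ultimately have p: "p \<in> ?P" and pm: "\<And>y. y \<in> ?P \<Longrightarrow> y \<le> p"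
      unfolding p_def using Max_in[of ?P] Max_ge[of ?P] by blast+
    have vp: "Suc v \<le> p" using p by (simp add: visible_def)
    have "visible F (Suc v) N \<inter> {p<..<b} = {}" using pm by force
    then have "b = Suc p \<or> (p, b) \<in> F"
      using visible_consecutive[OF ncF] p b by blast
    moreover have "p = Suc v \<or> p \<in> ?H" using p b vp by auto
    ultimately show ?thesis using a p vp by (intro exI[of _ p]) auto
  qed
  ultimately show ?thesis unfolding apex_closed_def using bounds
    by (intro conjI ballI) (blast, blast, clarify)
qed

lemma visible_Un:
  "visible (F \<union> G) a b = {x \<in> visible F a b. \<forall>e\<in>G. \<not> (fst e < x \<and> x < snd e)}"
  by (auto simp: visible_def)

text \<open>The longest new edge (v, x) hides exactly what lies strictly between v and x. For x =
  \<open>Suc v\<close> no edge is added, but then every old visible vertex is at least x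
  anyway.\<close>

lemma visible_fan:
  assumes F: "apex_closed (Suc v) N F" and x: "x \<in> visible F (Suc v) N"
  shows "visible (F \<union> Pair v ` {y \<in> visible F (Suc v) N. Suc v < y \<and> y \<le> x}) v N
       = insert v {y \<in> visible F (Suc v) N. x \<le> y}" (is "?L = ?R")
proof (rule set_eqI)
  fix z
  have xN: "Suc v \<le> x" "x \<le> N" using x by (auto simp: visible_def)
  show "z \<in> ?L \<longleftrightarrow> z \<in> ?R"
  proof (cases "z = v")
    case True
    then show ?thesis using xN apex_closed_edge[OF F] by (fastforce simp: visible_def)
  next
    case False
    then have "z \<in> visible F v N \<longleftrightarrow> z \<in> visible F (Suc v) N"
      by (auto simp: visible_def)
    then have "z \<in> ?L \<longleftrightarrow> z \<in> visible F (Suc v) N \<and>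
      (\<forall>y. y \<in> visible F (Suc v) N \<and> Suc v < y \<and> y \<le> x \<longrightarrow> \<not> (v < z \<and> z < y))"
      unfolding visible_Un by auto
    also have "\<dots> \<longleftrightarrow> z \<in> visible F (Suc v) N \<and> x \<le> z"
    proof (cases "z \<in> visible F (Suc v) N")
      case True
      then have "Suc v \<le> z" by (simp add: visible_def)
      then show ?thesis using True x xN by (cases "x = Suc v") (auto dest: spec[of _ x])
    qed simp
    finally show ?thesis using False by simp
  qed
qed

lemma exists_rank:
  fixes V :: "'a::linorder set"
  assumes "finite V" "c < card V"
  shows "\<exists>x\<in>V. card {y \<in> V. y \<le> x} = Suc c"
  using assms
proof (induction V arbitrary: c rule: finite_linorder_max_induct)
  case (insert b V)
  show ?case
  proof (cases "c < card V")
    case True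
    then obtain x where x: "x \<in> V" "card {y \<in> V. y \<le> x} = Suc c" using insert by blast
    have "{y \<in> insert b V. y \<le> x} = {y \<in> V. y \<le> x}" using x insert by fastforce
    then show ?thesis using x by (intro bexI[of _ x]) simp_all
  next
    case False
    then have "Suc c = card (insert b V)" using insert by (auto simp: card_insert_if)
    moreover have "{y \<in> insert b V. y \<le> b} = insert b V" using insert by auto
    ultimately show ?thesis by (intro bexI[of _ b]) simp_all
  qed
qed simp

text \<open>Here r stands for the column lengths. The invariant says that visible vertices and edges
  together are as many as the vertices v, ..., n + 1: passing to a smaller tail adds one visible
  vertex, and each new edge hides exactly one.\<close>

lemma exists_apex_closed:
  fixes r :: "nat \<Rightarrow> nat"
  assumes mono: "\<And>v. 1 \<le> v \<Longrightarrow> r (Suc v) \<le> r v" and le: "\<And>v. 1 \<le> v \<Longrightarrow> r v \<le> n - v"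
    and v: "v \<le> Suc n" "1 \<le> v"
  shows "\<exists>F. apex_closed v (Suc n) F \<and> card (visible F v (Suc n)) + r v = Suc (Suc n) - v
           \<and> (\<forall>u\<ge>v. card {e \<in> F. u \<le> fst e} = r u)"
  using v
proof (induction v rule: inc_induct)
  case base
  have "r u = 0" if "Suc n \<le> u" for u using le[of u] that by simp
  moreover have "visible {} (Suc n) (Suc n) = {Suc n}" by (auto simp: visible_def)
  ultimately show ?case by (intro exI[of _ "{}"]) (auto simp: apex_closed_def)
next
  case (step v)
  then obtain F where F: "apex_closed (Suc v) (Suc n) F"
    and vis: "card (visible F (Suc v) (Suc n)) + r (Suc v) = Suc n - v"
    and cnt: "\<And>u. Suc v \<le> u \<Longrightarrow> card {e \<in> F. u \<le> fst e} = r u" by auto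
  let ?V = "visible F (Suc v) (Suc n)"
  define c where "c = r v - r (Suc v)"
  have rv: "r v = r (Suc v) + c" "r v \<le> n - v" "v \<le> n"
    using mono[of v] le[of v] step.prems step.hyps by (auto simp: c_def)
  \<comment> \<open>The vertex \<open>Suc v\<close> is visible but cannot be a head, so c new edges
    need c + 1 visible vertices. By the invariant this amounts to \<open>r v \<le> n - v\<close>.
    The rank of x below is \<open>Suc c\<close> because it counts \<open>Suc v\<close> as
    well.\<close>
  then have "c < card ?V" using vis by linarith
  then obtain x where x: "x \<in> ?V" "card {y \<in> ?V. y \<le> x} = Suc c"
    using exists_rank[OF finite_visible] by blast
  let ?H = "{y \<in> ?V. Suc v < y \<and> y \<le> x}"
  let ?G = "F \<union> Pair v ` ?H"
  have xv: "Suc v \<le> x" using x by (simp add: visible_def)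
  have sv: "Suc v \<in> ?V"
    using apex_closed_edge[OF F] step.hyps by (fastforce simp: visible_def)
  have H: "?H = {y \<in> ?V. y \<le> x} - {Suc v}"
    using le_neq_implies_less by (auto simp: visible_def)
  have cH: "card ?H = c" unfolding H using x sv xv by (subst card_Diff_singleton) auto
  have "card ({y \<in> ?V. y \<le> x} \<union> {y \<in> ?V. x < y}) = card {y \<in> ?V. y \<le> x} + card {y \<in> ?V. x < y}"
    by (rule card_Un_disjoint) auto
  moreover have "{y \<in> ?V. y \<le> x} \<union> {y \<in> ?V. x < y} = ?V" by auto
  ultimately have above: "card ?V = Suc c + card {y \<in> ?V. x < y}" using x by simp
  have "{y \<in> ?V. x \<le> y} = insert x {y \<in> ?V. x < y}" using x by auto
  then have ge: "card {y \<in> ?V. x \<le> y} + c = card ?V" using above by simp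
  have "card (visible ?G v (Suc n)) = Suc (card {y \<in> ?V. x \<le> y})"
    unfolding visible_fan[OF F x(1)] by (subst card_insert_disjoint) (auto simp: visible_def)
  then have 1: "card (visible ?G v (Suc n)) + r v = Suc (Suc n) - v"
    using ge vis rv by linarith
  have old: "Suc v \<le> fst e" if "e \<in> F" for e
    using apex_closed_edge[OF F, of "fst e" "snd e"] that by simp
  have 2: "card {e \<in> ?G. u \<le> fst e} = r u" if u: "v \<le> u" for u
  proof (cases "u = v")
    case True
    have "{e \<in> ?G. u \<le> fst e} = F \<union> Pair v ` ?H" using True old by fastforce
    moreover have "card (F \<union> Pair v ` ?H) = card F + card (Pair v ` ?H)"
      using apex_closed_finite[OF F] old by (intro card_Un_disjoint) fastforce+
    moreover have "card (Pair v ` ?H) = c" using cH by (simp add: card_image inj_on_def)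
    moreover have "{e \<in> F. Suc v \<le> fst e} = F" using old by auto
    then have "card F = r (Suc v)" using cnt[of "Suc v"] by simp
    ultimately show ?thesis using rv True by simp
  next
    case False
    then have "{e \<in> ?G. u \<le> fst e} = {e \<in> F. u \<le> fst e}" using u by auto
    then show ?thesis using cnt[of u] u False by simp
  qed
  show ?case using apex_closed_fan[OF F x(1)] 1 2 by blast
qed

text \<open>A row k of length at least v satisfies v <= n - k, which confines k to 1, ..., n - v.
  This is the bound on r that \<open>exists_apex_closed\<close> asks for.\<close>

lemma Young_card_ge:
  assumes A: "A \<in> Young n" and v: "1 \<le> v"
  shows "finite {i. v \<le> A i}" "card {i. v \<le> A i} \<le> n - v"
proof -
  have sub: "{i. v \<le> A i} \<subseteq> {..<n - v}"
  proof
    fix i assume "i \<in> {i. v \<le> A i}"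
    then have i: "v \<le> row A (Suc i)" by (simp add: row_def)
    have "\<not> n \<le> Suc i"
    proof
      assume "n \<le> Suc i"
      then have "row A (Suc i) = 0" using A by (simp add: Young_def)
      then show False using i v by simp
    qed
    then have "row A (Suc i) \<le> n - Suc i" using A by (simp add: Young_def)
    then show "i \<in> {..<n - v}" using i v by auto
  qed
  show "finite {i. v \<le> A i}" by (rule finite_subset[OF sub]) simp
  show "card {i. v \<le> A i} \<le> n - v" using card_mono[OF _ sub] by simp
qed

lemma Young_in_Lam_image:
  assumes n: "1 \<le> n" and A: "A \<in> Young n"
  shows "A \<in> Lam ` triangulations (n + 2)"
proof -
  let ?N = "Suc n"
  define r where "r v = card {i. v \<le> A i}" for v
  have "r (Suc v) \<le> r v" if "1 \<le> v" for v
    unfolding r_def using Young_card_ge(1)[OF A that] by (intro card_mono) auto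
  then obtain F where F: "apex_closed 1 ?N F" and cnt: "\<And>u. 1 \<le> u \<Longrightarrow> card {e \<in> F. u \<le> fst e} = r u"
    using exists_apex_closed[of r n 1] Young_card_ge(2)[OF A] by (auto simp: r_def)
  let ?V = "visible F (Suc 0) ?N"
  \<comment> \<open>The endpoint \<open>?N\<close> joins 0 to every vertex that is still visible.
    The last of these edges is the side \<open>(0, ?N)\<close>, which is removed again in D. Edges
    with tail 0 do not affect the column lengths.\<close>
  let ?G = "F \<union> Pair 0 ` {y \<in> ?V. Suc 0 < y \<and> y \<le> ?N}"
  have F1: "apex_closed (Suc 0) ?N F" using F by simp
  have NV: "?N \<in> ?V" using apex_closed_edge[OF F] by (fastforce simp: visible_def)
  have G: "apex_closed 0 ?N ?G" by (rule apex_closed_fan[OF F1 NV])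
  have NG: "(0, ?N) \<in> ?G" using NV n by auto
  define D where "D = ?G - {(0, ?N)}"
  have ins: "insert (0, ?N) D = ?G" using NG by (auto simp: D_def)
  have D: "D \<in> triangulations (Suc ?N)"
    by (rule apex_closed_triangulation) (use n G ins in \<open>auto simp: D_def\<close>)
  have "Lam D = A"
  proof (rule antimono_eqI)
    show "antimono A" using A by (simp add: Young_def int_partition_def)
    fix v :: nat assume v: "1 \<le> v"
    have "{e \<in> D. v \<le> fst e} = {e \<in> F. v \<le> fst e}" using v by (auto simp: D_def)
    then show "card {i. v \<le> Lam D i} = card {i. v \<le> A i}"
      using card_Lam_ge[OF v triangulation_finite[OF D]] cnt[OF v] by (simp add: r_def)
    show "finite {i. v \<le> A i}" by (rule Young_card_ge(1)[OF A v])
  qed (auto simp: antimono_Lam finite_Lam_ge)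
  then show ?thesis using D by auto
qed

section \<open>Gluing a triangle onto the polygon, and its effect on flips\<close>

text \<open>The old edges, (0, N) among them, keep their apices. The only new edge is the closing
  side \<open>(0, Suc N)\<close>, with apex N.\<close>

lemma triangulation_glue:
  assumes N: "2 \<le> N" and X: "X \<in> triangulations (Suc N)"
  shows "insert (0, N) X \<in> triangulations (Suc (Suc N))" "Lam (insert (0, N) X) = Lam X"
proof -
  have G: "apex_closed 0 N (insert (0, N) X)" using triangulation_apex_closed[OF N X] by simp
  let ?G = "insert (0, Suc N) (insert (0, N) X)"
  have bd: "Suc a < b \<and> b \<le> N" if "(a, b) \<in> insert (0, N) X" for a b
    using apex_closed_edge[OF G that] by simp
  have "apex_closed 0 (Suc N) ?G"
    unfolding apex_closed_def
  proof (intro conjI)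
    show "\<forall>(a, b)\<in>?G. 0 \<le> a \<and> Suc a < b \<and> b \<le> Suc N" using bd N by fastforce
    have "\<not> crossing e f" if "e \<in> insert (0, N) X" "f \<in> insert (0, N) X" for e f
      using G that unfolding apex_closed_def by blast
    moreover have "\<not> crossing (0, Suc N) e \<and> \<not> crossing e (0, Suc N)" if "e \<in> insert (0, N) X" for e
      using bd[of "fst e" "snd e"] that by (auto simp: crossing_def)
    moreover have "\<not> crossing (0, Suc N) (0, Suc N)" by (simp add: crossing_def)
    ultimately show "\<forall>e\<in>?G. \<forall>f\<in>?G. \<not> crossing e f" by blast
    show "\<forall>(a, b)\<in>?G. \<exists>x>a. x < b \<and> (x = Suc a \<or> (a, x) \<in> ?G) \<and> (b = Suc x \<or> (x, b) \<in> ?G)"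
    proof (intro ballI, clarify)
      fix a b assume ab: "(a, b) \<in> ?G"
      show "\<exists>x>a. x < b \<and> (x = Suc a \<or> (a, x) \<in> ?G) \<and> (b = Suc x \<or> (x, b) \<in> ?G)"
      proof (cases "(a, b) \<in> insert (0, N) X")
        case True
        then obtain x where "a < x" "x < b" "x = Suc a \<or> (a, x) \<in> insert (0, N) X"
          "b = Suc x \<or> (x, b) \<in> insert (0, N) X"
          using apex_closed_apex[OF G] by blast
        then show ?thesis by (intro exI[of _ x]) auto
      next
        case False
        then have "a = 0" "b = Suc N" using ab by auto
        then show ?thesis using N by (intro exI[of _ N]) auto
      qed
    qed
  qed
  then show 1: "insert (0, N) X \<in> triangulations (Suc (Suc N))"
    by (intro apex_closed_triangulation) (use N bd in fastforce)+
  show "Lam (insert (0, N) X) = Lam X"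
  proof (rule antimono_eqI)
    fix v :: nat assume v: "1 \<le> v"
    have "{e \<in> insert (0, N) X. v \<le> fst e} = {e \<in> X. v \<le> fst e}" using v by auto
    then show "card {i. v \<le> Lam (insert (0, N) X) i} = card {i. v \<le> Lam X i}"
      using card_Lam_ge[OF v triangulation_finite] X 1 by simp
  qed (auto simp: antimono_Lam finite_Lam_ge)
qed

text \<open>The side (0, N) of the smaller polygon becomes a diagonal of the larger one, so it has
  to join the set that may bound Q. It cannot cut Q, whose vertices all lie in {0..N}.\<close>

lemma piece_glue:
  assumes N: "2 \<le> N" and Q: "piece (Suc N) E Q"
  shows "piece (Suc (Suc N)) (insert (0, N) E) Q"
proof -
  have sub: "Q \<subseteq> {..<Suc N}" using Q by (simp add: piece_def)
  have "(0, N) \<notin> diagonals Q"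
  proof
    assume "(0, N) \<in> diagonals Q"
    then have "\<not> Q \<subseteq> {0..N}" by (auto simp: diagonals_def sides_def)
    then show False using sub by auto
  qed
  moreover have "sides {..<Suc N} \<subseteq> sides {..<Suc (Suc N)} \<union> {(0, N)}"
    unfolding sides_polygon[OF N] using N by (subst sides_polygon) auto
  ultimately show ?thesis using Q sub unfolding piece_def by auto
qed

text \<open>The only piece beyond (0, N) is the glued triangle, which is too small. A larger piece
  containing \<open>Suc N\<close> would also contain 0, N and a fourth vertex, and (0, N) would cut
  it.\<close>

lemma piece_unglue:
  assumes N: "2 \<le> N" and Q: "piece (Suc (Suc N)) (insert (0, N) E) Q" "4 \<le> card Q"
    and E: "\<And>a b. (a, b) \<in> E \<Longrightarrow> b \<le> N"
  shows "piece (Suc N) E Q"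
proof -
  have sub: "Q \<subseteq> {..<Suc (Suc N)}"
    and sd: "sides Q \<subseteq> sides {..<Suc (Suc N)} \<union> insert (0, N) E"
    and dg: "diagonals Q \<inter> insert (0, N) E = {}" using Q by (auto simp: piece_def)
  have fin: "finite Q" using sub finite_subset by blast
  \<comment> \<open>Neither (0, N) nor a member of E reaches \<open>Suc N\<close>, so such a side of
    Q is a side of the polygon.\<close>
  have top: "a = 0 \<or> a = N" if "(a, Suc N) \<in> sides Q" for a
    using that sd E[of a "Suc N"] sides_polygon[of "Suc N"] N by auto
  have notsub: "\<not> Q \<subseteq> {x, y, z}" for x y z
  proof
    assume "Q \<subseteq> {x, y, z}"
    then have "card Q \<le> card {x, y, z}" by (intro card_mono) auto
    also have "\<dots> \<le> 3" by (simp add: card_insert_if)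
    finally show False using Q(2) by simp
  qed
  have "Suc N \<notin> Q"
  proof
    assume SQ: "Suc N \<in> Q"
    \<comment> \<open>\<open>Max ?R\<close> and \<open>Min ?R\<close> are the two cyclic neighbours
      of \<open>Suc N\<close> in Q.\<close>
    let ?R = "Q - {Suc N}"
    have R: "finite ?R" "?R \<noteq> {}" using fin notsub[of "Suc N" "Suc N" "Suc N"] by auto
    have p: "Max ?R \<in> Q" "Max ?R \<noteq> Suc N" "Max ?R < Suc N" and pm: "\<And>x. x \<in> ?R \<Longrightarrow> x \<le> Max ?R"
      using Max_in[OF R] Max_ge[OF R(1)] sub by auto
    have a: "Min ?R \<in> Q" "Min ?R < Suc N" and am: "\<And>x. x \<in> ?R \<Longrightarrow> Min ?R \<le> x"
      using Min_in[OF R] Min_le[OF R(1)] sub by auto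
    have "Q \<inter> {Max ?R<..<Suc N} = {}" using pm by fastforce
    then have "(Max ?R, Suc N) \<in> sides Q" using p SQ by (auto simp: sides_def)
    then have pN: "Max ?R = 0 \<or> Max ?R = N" by (rule top)
    have "Q \<subseteq> {Min ?R..Suc N}"
    proof
      fix x assume x: "x \<in> Q"
      then have "x \<le> Suc N" using sub by auto
      moreover have "Min ?R \<le> x" using am[of x] x a(2) by (cases "x = Suc N") auto
      ultimately show "x \<in> {Min ?R..Suc N}" by simp
    qed
    then have "(Min ?R, Suc N) \<in> sides Q" using a SQ by (auto simp: sides_def)
    then have aN: "Min ?R = 0 \<or> Min ?R = N" by (rule top)
    have "Max ?R \<noteq> 0"
    proof
      assume "Max ?R = 0"
      then have "Q \<subseteq> {0, Suc N, Suc N}" using pm by auto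
      then show False using notsub by blast
    qed
    then have NQ: "N \<in> Q" using p pN by auto
    have "Min ?R \<noteq> N"
    proof
      assume "Min ?R = N"
      then have "N \<le> x" if "x \<in> ?R" for x using am[OF that] by simp
      then have "Q \<subseteq> {N, Suc N, Suc N}" using sub by (auto simp: less_Suc_eq) fastforce
      then show False using notsub by blast
    qed
    then have ZQ: "0 \<in> Q" using a aN by auto
    \<comment> \<open>The vertices t and \<open>Suc N\<close> lie on different sides of (0, N),
      which makes it a diagonal of Q.\<close>
    obtain t where t: "t \<in> Q" "t \<noteq> 0" "t \<noteq> N" "t \<noteq> Suc N" using notsub[of 0 N "Suc N"] by auto
    then have "t \<in> Q \<inter> {0<..<N}" using sub by fastforce
    then have "(0, N) \<in> diagonals Q"
      using NQ ZQ SQ N by (auto simp: diagonals_def sides_def)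
    then show False using dg by blast
  qed
  then have sub': "Q \<subseteq> {..<Suc N}" using sub by (auto simp: less_Suc_eq)
  have "sides Q \<subseteq> sides {..<Suc N} \<union> E"
  proof (rule subrelI)
    fix a b assume ab: "(a, b) \<in> sides Q"
    then have "b \<le> N" using sub' by (auto simp: sides_def)
    then show "(a, b) \<in> sides {..<Suc N} \<union> E"
      using ab sd N sides_polygon[of N] sides_polygon[of "Suc N"] by auto
  qed
  then show ?thesis using Q dg sub' by (auto simp: piece_def)
qed

lemma flip_glue:
  assumes N: "2 \<le> N" and X: "X \<in> triangulations (Suc N)" and Y: "Y \<in> triangulations (Suc N)"
  shows "flip (Suc (Suc N)) (insert (0, N) X) (insert (0, N) Y) \<longleftrightarrow> flip (Suc N) X Y"
proof -
  have gX: "(0, N) \<notin> X" and gY: "(0, N) \<notin> Y"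
    using triangulation_apex_closed(1)[OF N] X Y by auto
  show ?thesis
  proof
    assume "flip (Suc N) X Y"
    then obtain e f Q where e: "e \<in> X" and Q: "piece (Suc N) (X - {e}) Q" "card Q = 4"
      "diagonals Q = {e, f}" "f \<noteq> e" and Yeq: "Y = insert f (X - {e})"
      unfolding flip_def by blast
    have "e \<noteq> (0, N)" using e gX by auto
    then have "insert (0, N) X - {e} = insert (0, N) (X - {e})" by auto
    then have "piece (Suc (Suc N)) (insert (0, N) X - {e}) Q"
      "insert (0, N) Y = insert f (insert (0, N) X - {e})"
      using piece_glue[OF N Q(1)] Yeq by auto
    then show "flip (Suc (Suc N)) (insert (0, N) X) (insert (0, N) Y)"
      unfolding flip_def using triangulation_glue(1)[OF N] X Y e Q by blast
  next
    assume "flip (Suc (Suc N)) (insert (0, N) X) (insert (0, N) Y)"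
    then obtain e f Q where e: "e \<in> insert (0, N) X"
      and Q: "piece (Suc (Suc N)) (insert (0, N) X - {e}) Q" "card Q = 4"
      "diagonals Q = {e, f}" "f \<noteq> e" and Yeq: "insert (0, N) Y = insert f (insert (0, N) X - {e})"
      unfolding flip_def by blast
    \<comment> \<open>Otherwise (0, N) would be missing from the right-hand side of
      \<open>Yeq\<close>.\<close>
    have ne: "e \<noteq> (0, N)" using Yeq Q(4) by auto
    then have eX: "e \<in> X" and diff: "insert (0, N) X - {e} = insert (0, N) (X - {e})" using e by auto
    \<comment> \<open>As (0, N) is not removed, it belongs to the set that does not cut Q, whereas f
      is a diagonal of Q.\<close>
    have "f \<noteq> (0, N)" using Q(1,3) unfolding diff piece_def by auto
    then have "(0, N) \<notin> insert f (X - {e})" using gX by auto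
    moreover have "insert (0, N) Y = insert (0, N) (insert f (X - {e}))"
      using Yeq unfolding diff by (simp add: insert_commute)
    ultimately have "Y = insert f (X - {e})" using gY insert_ident by metis
    moreover have "b \<le> N" if "(a, b) \<in> X" for a b
      using X that by (auto simp: triangulations_def diagonals_def)
    then have "piece (Suc N) (X - {e}) Q"
      using Q(1,2) unfolding diff by (intro piece_unglue[OF N]) auto
    ultimately show "flip (Suc N) X Y"
      unfolding flip_def using X Y eX Q by blast
  qed
qed

section \<open>Transfer of flips between different sizes of the triangle\<close>

lemma Young_Suc:
  assumes "1 \<le> n"
  shows "Young n \<subseteq> Young (Suc n)"
proof
  fix A assume A: "A \<in> Young n"
  have "row A k \<le> Suc n - k" if "1 \<le> k" for k
  proof (cases "k \<le> n - 1")
    case True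
    then have "row A k \<le> n - k" using A that by (simp add: Young_def)
    then show ?thesis by simp
  next
    case False
    then have "row A k = 0" using A by (simp add: Young_def)
    then show ?thesis by simp
  qed
  then show "A \<in> Young (Suc n)" using A by (simp add: Young_def)
qed

lemma Young_mono:
  assumes "1 \<le> n" "n \<le> k"
  shows "Young n \<subseteq> Young k"
  using assms(2)
proof (induction k rule: dec_induct)
  case (step m)
  then show ?case using Young_Suc[of m] assms(1) by auto
qed simp

text \<open>The glued triangulation is mapped to A, and by injectivity of \<open>Lam\<close> it is
  the only preimage that \<open>inv_into\<close> can choose.\<close>

lemma inv_Lam_Suc:
  assumes n: "1 \<le> n" and A: "A \<in> Young n"
  defines "X \<equiv> inv_into (triangulations (n + 2)) Lam A"
  shows "X \<in> triangulations (Suc (Suc n))"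
    "inv_into (triangulations (Suc n + 2)) Lam A = insert (0, Suc n) X"
proof -
  have N: "2 \<le> Suc n" using n by simp
  show X: "X \<in> triangulations (Suc (Suc n))"
    using inv_into_into[OF Young_in_Lam_image[OF n A]] by (simp add: X_def)
  have "Lam X = A" unfolding X_def by (rule f_inv_into_f[OF Young_in_Lam_image[OF n A]])
  then show "inv_into (triangulations (Suc n + 2)) Lam A = insert (0, Suc n) X"
    using triangulation_glue[OF N X] inj_on_Lam[of "Suc (Suc n)"] n
    by (intro inv_into_f_eq) auto
qed

lemma young_flip_Suc:
  assumes n: "1 \<le> n" and A: "A \<in> Young n" and B: "B \<in> Young n"
  shows "young_flip (Suc n) A B \<longleftrightarrow> young_flip n A B"
proof -
  have "2 \<le> Suc n" using n by simp
  from flip_glue[OF this inv_Lam_Suc(1)[OF n A] inv_Lam_Suc(1)[OF n B]]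
  show ?thesis
    unfolding young_flip_def inv_Lam_Suc(2)[OF n A] inv_Lam_Suc(2)[OF n B]
    using A B Young_Suc[OF n] by auto
qed

text \<open>The equivalence serves both directions of the theorem: for k below n it is applied with
  n and k exchanged.\<close>

lemma young_flip_le:
  assumes n: "1 \<le> n" and A: "A \<in> Young n" and B: "B \<in> Young n" and k: "n \<le> k"
  shows "young_flip k A B \<longleftrightarrow> young_flip n A B"
  using k
proof (induction k rule: dec_induct)
  case (step m)
  have "1 \<le> m" using n step.hyps by simp
  then show ?case
    using young_flip_Suc[of m A B] step.IH Young_mono[OF n step.hyps(1)] A B by blast
qed simp

theorem theorem1:
  fixes n :: nat and A B :: "nat \<Rightarrow> nat"
  assumes "n \<ge> 1" and "A \<in> Young n" and "B \<in> Young n" and "young_flip n A B"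
  shows "(\<forall>k\<ge>1. A \<in> Young k \<and> B \<in> Young k \<longrightarrow> young_flip k A B)
       \<and> (\<forall>k>n. young_flip k A B)"
proof (intro conjI allI impI)
  fix k assume "1 \<le> k" "A \<in> Young k \<and> B \<in> Young k"
  then show "young_flip k A B"
    using young_flip_le[of n A B k] young_flip_le[of k A B n] assms by (cases "n \<le> k") auto
next
  fix k assume "n < k"
  then show "young_flip k A B" using young_flip_le[of n A B k] assms by simp
qed

end
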